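(* Let $G$ be a compactly finite-dimensional topological group and let $X\subset G$ be a subspace that is locally continuum-connected and cosmic. Then $X$ is metrizable. If, in addition, $X$ is closed in $G$, then $X$ is metrizable and locally compact.
   Context: Topological groups are assumed Hausdorff. $\dim$ denotes the covering dimension. A topological group $G$ is called compactly finite-dimensional if $\sup\{\dim(K): K \text{ is a compact subspace of } G\}$ is finite. A continuum is a connected compact Hausdorff space. Two points $x,y$ of a topological space $X$ are connected by a subcontinuum $K\subset X$ if $x,y\in K$. A topological space $X$ is locally continuum-connected at a point $x\in X$ if for every neighborhood $U\subset X$ of $x$ there is another neighborhood $V\subset U$ of $x$ such that each point $y\in V$ can be connected with $x$ by a subcontinuum $K\subset U$. A space is locally continuum-connected if it is locally continuum-connected at each of its points. A regular topological space is cosmic if it is a continuous image of a separable metrizable space (equivalently, if it has countable network weight). *)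

theory Defs
  imports "HOL-Analysis.Analysis"
begin

definition covering_dim_le :: "'a topology \<Rightarrow> int \<Rightarrow> bool" where
  "covering_dim_le X n \<longleftrightarrow>
     (\<forall>\<U>. finite \<U> \<and> (\<forall>U\<in>\<U>. openin X U) \<and> \<Union>\<U> = topspace X \<longrightarrow>
        (\<exists>\<V>. finite \<V> \<and> (\<forall>V\<in>\<V>. openin X V) \<and> \<Union>\<V> = topspace X \<and>
             (\<forall>V\<in>\<V>. \<exists>U\<in>\<U>. V \<subseteq> U) \<and>
             (\<forall>x\<in>topspace X. int (card {V\<in>\<V>. x \<in> V}) \<le> n + 1)))"

(* The value is -1 exactly for the empty space, and \<infinity> if no n works
   (the infimum of the empty set of extended reals). *)
definition covering_dim :: "'a topology \<Rightarrow> ereal" where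
  "covering_dim X = Inf {ereal (real_of_int n) |n. n \<ge> -1 \<and> covering_dim_le X n}"

(* The supremum is never -\<infinity>: the empty set is compact, of dimension -1. *)
definition compactly_finite_dimensional :: "'a topology \<Rightarrow> bool" where
  "compactly_finite_dimensional X \<longleftrightarrow>
     (SUP K\<in>{K. compactin X K}. covering_dim (subtopology X K)) < \<infinity>"

definition continuum :: "'a topology \<Rightarrow> bool" where
  "continuum X \<longleftrightarrow> connected_space X \<and> compact_space X \<and> Hausdorff_space X"

definition locally_continuum_connected_at :: "'a topology \<Rightarrow> 'a \<Rightarrow> bool" where
  "locally_continuum_connected_at X x \<longleftrightarrow>
     (\<forall>U. openin X U \<and> x \<in> U \<longrightarrow>
        (\<exists>V. openin X V \<and> x \<in> V \<and> V \<subseteq> U \<and>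
             (\<forall>y\<in>V. \<exists>K. K \<subseteq> U \<and> continuum (subtopology X K) \<and> x \<in> K \<and> y \<in> K)))"

definition locally_continuum_connected :: "'a topology \<Rightarrow> bool" where
  "locally_continuum_connected X \<longleftrightarrow> (\<forall>x\<in>topspace X. locally_continuum_connected_at X x)"

(* HOL cannot quantify over types inside a formula, so the separable metrizable
   preimage M is taken on a subset of the reals. Nothing is lost, since separable
   metrizable spaces have at most continuum many points; see cosmic_spaceI below.
   The library's regularity does not include T1, hence the Hausdorff conjunct. *)
definition cosmic_space :: "'a topology \<Rightarrow> bool" where
  "cosmic_space X \<longleftrightarrow> regular_space X \<and> Hausdorff_space X \<and>
     (\<exists>(M :: real topology) f. metrizable_space M \<and> separable_space M \<and>
        continuous_map M X f \<and> f ` topspace M = topspace X)"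

lemma separable_metrizable_inj_real:
  assumes "metrizable_space M" "separable_space M"
  obtains g :: "'b \<Rightarrow> real" where "inj_on g (topspace M)"
proof -
  obtain A d where "Metric_space A d" and M: "M = Metric_space.mtopology A d"
    using assms(1) unfolding metrizable_space_def by blast
  then interpret Metric_space A d by simp
  obtain D where D: "countable D" "D \<subseteq> topspace M" "M closure_of D = topspace M"
    using assms(2) unfolding separable_space_def by blast
  define e where "e = from_nat_into D"
  define c where "c x = {(n, k). d x (e n) < 1 / real (Suc k)}" for x
  have "inj_on c A"
  proof (rule inj_onI, rule ccontr)
    fix x y assume xy: "x \<in> A" "y \<in> A" "c x = c y" "x \<noteq> y"
    then have "d x y / 2 > 0" by (simp add: mdist_pos_less)
    then obtain k where k: "1 / real (Suc k) < d x y / 2"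
      using nat_approx_posE by blast
    have "x \<in> mtopology closure_of D" using D xy M by simp
    then obtain z where z: "z \<in> D" "z \<in> mball x (1 / real (Suc k))"
      unfolding metric_closure_of by (auto dest: spec[of _ "1 / real (Suc k)"])
    then obtain n where n: "e n = z"
      using D(1) unfolding e_def by (metis from_nat_into_surj)
    have zA: "z \<in> A" using z by simp
    have "(n, k) \<in> c x" using z n by (simp add: c_def)
    then have "(n, k) \<in> c y" using xy by simp
    then have "d y z < 1 / real (Suc k)" using n by (simp add: c_def)
    moreover have "d x z < 1 / real (Suc k)" using z by simp
    moreover have "d x y \<le> d x z + d y z" using triangle[OF xy(1) zA xy(2)] commute[of y z] by simp
    ultimately show False using k by linarith
  qed
  moreover obtain h :: "nat set \<Rightarrow> real" where "inj h"
    using nat_sets_eqpoll_reals unfolding eqpoll_def bij_betw_def by blast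
  moreover have "inj (image prod_encode)"
    by (simp add: inj_image_eq_iff inj_def inj_prod_encode)
  ultimately have "inj_on (h \<circ> (image prod_encode \<circ> c)) A"
    by (intro comp_inj_on) (auto intro: inj_on_subset)
  with that M show thesis by simp
qed

lemma cosmic_spaceI:
  fixes M :: "'b topology" and X :: "'a topology"
  assumes "regular_space X" "Hausdorff_space X" "metrizable_space M" "separable_space M"
    and f: "continuous_map M X f" "f ` topspace M = topspace X"
  shows "cosmic_space X"
proof -
  obtain g :: "'b \<Rightarrow> real" where g: "inj_on g (topspace M)"
    using separable_metrizable_inj_real assms(3,4) by blast
  define q where "q = inv_into (topspace M) g"
  define N where "N = pullback_topology (g ` topspace M) q M"
  have qg: "q (g x) = x" if "x \<in> topspace M" for x
    using g that by (simp add: q_def)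
  have tN: "topspace N = g ` topspace M"
    using qg by (auto simp: N_def topspace_pullback_topology)
  have q: "continuous_map N M q"
    using continuous_map_pullback[of M M id] by (simp add: N_def)
  have "continuous_map M N g"
    unfolding N_def
    by (rule continuous_map_pullback') (auto simp: continuous_map_eq[OF continuous_map_id] qg)
  with q have "homeomorphic_maps M N g q"
    by (auto simp: homeomorphic_maps_def tN qg)
  then have hom: "M homeomorphic_space N"
    unfolding homeomorphic_space_def by blast
  have "continuous_map N X (f \<circ> q)" using q f(1) by (rule continuous_map_compose)
  moreover have "(f \<circ> q) ` topspace N = topspace X"
    using f(2) qg by (simp add: tN image_image)
  ultimately show ?thesis
    unfolding cosmic_space_def
    using assms hom homeomorphic_metrizable_space homeomorphic_separable_space by blast
qed

end

theory Submission
  imports Defs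
begin

text \<open>
  Choose continua \<open>C\<^sub>1, C\<^sub>2, \<dots>\<close> in translates of \<open>X\<close> through \<open>0\<close>, with points \<open>c\<^sub>i \<in> C\<^sub>i\<close>, such that the
  translate by \<open>c\<^sub>i\<close> of \<open>K = C\<^sub>1 + \<dots> + C\<^sub>i\<^sub>-\<^sub>1\<close> misses \<open>K\<close> and the later continua are so small that all
  pairs of opposite faces of the sum stay disjoint. A chain of points in each \<open>C\<^sub>i\<close> maps a fine cubical
  grid into \<open>C\<^sub>1 + \<dots> + C\<^sub>m\<close>, faces going to faces, so Kuhn's combinatorial lemma forces the
  covering dimension of the sum to be at least \<open>m\<close>. As dimensions are bounded, the construction gets
  stuck at every \<open>x \<in> X\<close>: some neighbourhood of \<open>x\<close> in \<open>X\<close> lies in the compact set \<open>x - K + K\<close>. This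
  set is cosmic, hence second countable, and \<open>X\<close> is Lindelof, so Urysohn's metrization theorem
  applies; if \<open>X\<close> is closed, it is locally compact.
\<close>

section \<open>Urysohn metrization\<close>

text \<open>Urysohn functions for countably many pairs of basic sets embed \<open>X\<close> into a
  countable power of the real line, which is metrizable.\<close>

theorem regular_second_countable_imp_metrizable_space:
  assumes reg: "regular_space X" and haus: "Hausdorff_space X" and sc: "second_countable X"
  shows "metrizable_space X"
proof -
  obtain \<B> where \<B>: "countable \<B>" "\<And>V. V \<in> \<B> \<Longrightarrow> openin X V"
    and base: "\<And>U x. openin X U \<Longrightarrow> x \<in> U \<Longrightarrow> \<exists>V\<in>\<B>. x \<in> V \<and> V \<subseteq> U"
    using sc by (auto simp: second_countable_def)
  have norm: "normal_space X"
    by (simp add: reg regular_Lindelof_imp_normal_space sc second_countable_imp_Lindelof_space)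
  \<comment> \<open>By regularity there are enough pairs: inside a basic neighbourhood
    \<open>B'\<close> of a point fits a basic \<open>B\<close> around it with closure in
    \<open>B'\<close>. This is what \<open>sep\<close> exploits.\<close>
  define I where "I = {(B, B'). B \<in> \<B> \<and> B' \<in> \<B> \<and> X closure_of B \<subseteq> B'}"
  have "countable I"
    by (rule countable_subset[of _ "\<B> \<times> \<B>"]) (auto simp: I_def \<B>)
  have "\<exists>f. continuous_map X euclideanreal f \<and> f ` (X closure_of fst p) \<subseteq> {0} \<and>
            f ` (topspace X - snd p) \<subseteq> {1}" if "p \<in> I" for p
  proof -
    have "disjnt (X closure_of fst p) (topspace X - snd p)"
      "closedin X (topspace X - snd p)"
      using that \<B> by (auto simp: I_def disjnt_def)
    then show ?thesis
      by (meson Urysohn_lemma_alt[OF norm] closedin_closure_of)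
  qed
  then obtain f where f_all: "\<forall>p\<in>I. continuous_map X euclideanreal (f p) \<and>
      f p ` (X closure_of fst p) \<subseteq> {0} \<and> f p ` (topspace X - snd p) \<subseteq> {1}"
    by metis
  then have f: "\<And>p. p \<in> I \<Longrightarrow> continuous_map X euclideanreal (f p)"
    and f0: "\<And>p x. p \<in> I \<Longrightarrow> x \<in> X closure_of fst p \<Longrightarrow> f p x = 0"
    and f1: "\<And>p x. p \<in> I \<Longrightarrow> x \<in> topspace X - snd p \<Longrightarrow> f p x = 1"
    by (auto simp: image_subset_iff)
  have sep: "\<exists>p\<in>I. f p x = 0 \<and> (\<forall>y \<in> topspace X - U. f p y = 1)" if U: "openin X U" "x \<in> U" for U x
  proof -
    obtain B' where B': "B' \<in> \<B>" "x \<in> B'" "B' \<subseteq> U" using base U by blast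
    obtain W C where W: "openin X W" "closedin X C" "x \<in> W" "W \<subseteq> C" "C \<subseteq> B'"
      using reg B' \<B>(2) unfolding neighbourhood_base_of_closedin[symmetric] neighbourhood_base_of
      by meson
    obtain B where B: "B \<in> \<B>" "x \<in> B" "B \<subseteq> W" using base W by blast
    have "X closure_of B \<subseteq> B'"
      using W B by (meson closure_of_minimal order_trans)
    then have "(B, B') \<in> I" using B B' by (simp add: I_def)
    moreover have "x \<in> X closure_of B"
      using B \<B>(2) closure_of_subset openin_subset by (metis subsetD)
    ultimately show ?thesis
      using f0[of "(B, B')"] f1[of "(B, B')"] B' by fastforce
  qed
  define P where "P = product_topology (\<lambda>_. euclideanreal) I"
  define e where "e x = (\<lambda>p\<in>I. f p x)" for x
  have e_p: "e x p = f p x" if "p \<in> I" for x p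
    using that by (simp add: e_def)
  have cont: "continuous_map X P e"
    unfolding P_def continuous_map_componentwise
  proof (intro conjI ballI)
    show "e ` topspace X \<subseteq> extensional I" by (auto simp: e_def)
    show "continuous_map X euclideanreal (\<lambda>x. e x p)" if "p \<in> I" for p
      using f[OF that] that by (simp add: e_p)
  qed
  have inj: "inj_on e (topspace X)"
  proof (rule inj_onI, rule ccontr)
    fix x y assume xy: "x \<in> topspace X" "y \<in> topspace X" "e x = e y" "x \<noteq> y"
    then have "openin X (topspace X - {y})"
      by (simp add: closedin_Hausdorff_singleton haus openin_diff)
    then obtain p where "p \<in> I" "f p x = 0" "f p y = 1"
      using sep[of _ x] xy by force
    then show False using xy e_p by (metis zero_neq_one)
  qed
  define Q where "Q = subtopology P (e ` topspace X)"
  have topQ: "topspace Q = e ` topspace X"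
    using cont by (auto simp: Q_def continuous_map_def)
  have "open_map X Q e"
    unfolding open_map_def
  proof (intro allI impI, subst openin_subopen, intro ballI)
    fix U y assume U: "openin X U" "y \<in> e ` U"
    then obtain x where x: "x \<in> U" "y = e x" by blast
    \<comment> \<open>The slice of the image where coordinate \<open>p\<close> is below 1 is an open
      neighbourhood of \<open>y\<close> made of images of points of \<open>U\<close> only.\<close>
    obtain p where p: "p \<in> I" "f p x = 0" "\<And>z. z \<in> topspace X - U \<Longrightarrow> f p z = 1"
      using sep[OF U(1) x(1)] by blast
    have "continuous_map Q euclideanreal (\<lambda>z. z p)"
      unfolding Q_def P_def
      by (intro continuous_map_from_subtopology continuous_map_product_projection p)
    then have "openin Q {z \<in> topspace Q. z p \<in> {..<1}}"
      by (rule openin_continuous_map_preimage) (simp add: open_openin[symmetric])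
    moreover have "y \<in> {z \<in> topspace Q. z p \<in> {..<1}}"
      using x p openin_subset[OF U(1)] by (auto simp: topQ e_p)
    moreover have "{z \<in> topspace Q. z p \<in> {..<1}} \<subseteq> e ` U"
      using p by (fastforce simp: topQ e_p)
    ultimately show "\<exists>T. openin Q T \<and> y \<in> T \<and> T \<subseteq> e ` U" by blast
  qed
  moreover have "continuous_map X Q e"
    using cont by (simp add: Q_def continuous_map_in_subtopology)
  ultimately have "homeomorphic_map X Q e"
    using bijective_open_imp_homeomorphic_map inj topQ by metis
  then have "X homeomorphic_space Q" by (rule homeomorphic_map_imp_homeomorphic_space)
  moreover have "metrizable_space P"
    unfolding P_def metrizable_space_product_topology
    using \<open>countable I\<close> by (auto simp: metrizable_space_euclidean intro: countable_subset[of _ I])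
  ultimately show ?thesis
    by (simp add: Q_def homeomorphic_metrizable_space metrizable_space_subtopology)
qed

section \<open>Countable networks\<close>

text \<open>Members need be neither open nor contained in \<open>S\<close>; their traces on
  \<open>S\<close> form a network of the subspace.\<close>

definition countable_network :: "'a::topological_space set \<Rightarrow> bool" where
  "countable_network S \<longleftrightarrow>
     (\<exists>\<N>. countable \<N> \<and> (\<forall>U x. open U \<longrightarrow> x \<in> S \<inter> U \<longrightarrow> (\<exists>N\<in>\<N>. x \<in> N \<and> N \<subseteq> U)))"

lemma countable_network_subset:
  "countable_network T \<Longrightarrow> S \<subseteq> T \<Longrightarrow> countable_network S"
  unfolding countable_network_def by (meson Int_iff subsetD)

lemma countable_network_singleton: "countable_network {x}"
  unfolding countable_network_def by (rule exI[of _ "{{x}}"]) auto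

text \<open>The advantage of networks over bases: as members need not be open, continuous images of
  a network form a network.\<close>

lemma countable_network_image:
  assumes "countable_network S" "continuous_on S f"
  shows "countable_network (f ` S)"
proof -
  obtain \<N> where \<N>: "countable \<N>"
      "\<And>U x. open U \<Longrightarrow> x \<in> S \<inter> U \<Longrightarrow> \<exists>N\<in>\<N>. x \<in> N \<and> N \<subseteq> U"
    using assms(1) unfolding countable_network_def by blast
  have "\<exists>N\<in>(\<lambda>N. f ` (N \<inter> S)) ` \<N>. y \<in> N \<and> N \<subseteq> U" if U: "open U" "y \<in> f ` S \<inter> U" for U y
  proof -
    obtain x where x: "x \<in> S" "y = f x" using U by blast
    obtain O' where O': "open O'" "O' \<inter> S = f -` U \<inter> S"
      using assms(2) U(1) unfolding continuous_on_open_invariant by blast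
    then obtain N where "N \<in> \<N>" "x \<in> N" "N \<subseteq> O'"
      using \<N>(2)[of O' x] x U by blast
    then show ?thesis using x O' by blast
  qed
  then show ?thesis
    unfolding countable_network_def using \<N>(1)
    by (intro exI[of _ "(\<lambda>N. f ` (N \<inter> S)) ` \<N>"]) blast
qed

lemma countable_network_Times:
  assumes "countable_network S" "countable_network T"
  shows "countable_network (S \<times> T)"
proof -
  obtain \<M> where \<M>: "countable \<M>"
      "\<And>U x. open U \<Longrightarrow> x \<in> S \<inter> U \<Longrightarrow> \<exists>N\<in>\<M>. x \<in> N \<and> N \<subseteq> U"
    using assms(1) unfolding countable_network_def by blast
  obtain \<N> where \<N>: "countable \<N>"
      "\<And>U x. open U \<Longrightarrow> x \<in> T \<inter> U \<Longrightarrow> \<exists>N\<in>\<N>. x \<in> N \<and> N \<subseteq> U"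
    using assms(2) unfolding countable_network_def by blast
  have "\<exists>N\<in>(\<lambda>(M, N). M \<times> N) ` (\<M> \<times> \<N>). z \<in> N \<and> N \<subseteq> U"
    if U: "open U" "z \<in> S \<times> T \<inter> U" for U z
  proof -
    obtain x y where z: "z = (x, y)" by (cases z)
    obtain A B where AB: "open A" "open B" "z \<in> A \<times> B" "A \<times> B \<subseteq> U"
      by (rule open_prod_elim[OF U(1) IntD2[OF U(2)]])
    obtain M N where "M \<in> \<M>" "x \<in> M" "M \<subseteq> A" "N \<in> \<N>" "y \<in> N" "N \<subseteq> B"
      using \<M>(2)[of A x] \<N>(2)[of B y] AB U z by blast
    then show ?thesis using AB z by (intro bexI[of _ "M \<times> N"]) auto
  qed
  then show ?thesis
    unfolding countable_network_def using \<M>(1) \<N>(1)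
    by (intro exI[of _ "(\<lambda>(M, N). M \<times> N) ` (\<M> \<times> \<N>)"]) blast
qed

lemma metrizable_separable_imp_second_countable:
  assumes "metrizable_space X" "separable_space X"
  shows "second_countable X"
proof -
  obtain A d where "Metric_space A d" and X: "X = Metric_space.mtopology A d"
    using assms(1) unfolding metrizable_space_def by blast
  then interpret Metric_space A d by simp
  obtain D where D: "countable D" "D \<subseteq> A" "mtopology closure_of D = A"
    using assms(2) X unfolding separable_space_def by auto
  define \<B> where "\<B> = (\<lambda>(z, k). mball z (1 / real (Suc k))) ` (D \<times> UNIV)"
  have "\<exists>V\<in>\<B>. x \<in> V \<and> V \<subseteq> U" if U: "openin mtopology U" "x \<in> U" for U x
  proof -
    obtain r where r: "r > 0" "mball x r \<subseteq> U" and x: "x \<in> A"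
      using U by (metis openin_mtopology subsetD)
    \<comment> \<open>Half of \<open>r\<close> leaves room for the triangle inequality after the
      centre moves from \<open>x\<close> to a point of \<open>D\<close>.\<close>
    obtain k where k: "1 / real (Suc k) < r / 2"
      using r nat_approx_posE half_gt_zero by blast
    have "x \<in> mtopology closure_of D" using D x by simp
    then obtain z where z: "z \<in> D" "z \<in> mball x (1 / real (Suc k))"
      unfolding metric_closure_of by (auto dest: spec[of _ "1 / real (Suc k)"])
    have "mball z (1 / real (Suc k)) \<subseteq> mball x r"
    proof
      fix y assume y: "y \<in> mball z (1 / real (Suc k))"
      then have "d x y \<le> d x z + d z y" using z x by (intro triangle) auto
      then show "y \<in> mball x r" using y z k by (simp del: of_nat_Suc)
    qed
    moreover have "x \<in> mball z (1 / real (Suc k))"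
      using z x by (simp add: commute)
    ultimately show ?thesis
      using r z unfolding \<B>_def by (intro bexI[of _ "mball z (1 / real (Suc k))"]) auto
  qed
  moreover have "countable \<B>" using D by (auto simp: \<B>_def)
  moreover have "\<forall>V\<in>\<B>. openin mtopology V" by (auto simp: \<B>_def)
  ultimately show ?thesis unfolding second_countable_def X by blast
qed

lemma cosmic_space_imp_countable_network:
  assumes "cosmic_space (top_of_set S)"
  shows "countable_network S"
proof -
  obtain M :: "real topology" and f where M: "metrizable_space M" "separable_space M"
    and f: "continuous_map M (top_of_set S) f" "f ` topspace M = S"
    using assms unfolding cosmic_space_def by auto
  obtain \<B> where \<B>: "countable \<B>"
    and base: "\<And>U x. openin M U \<Longrightarrow> x \<in> U \<Longrightarrow> \<exists>V\<in>\<B>. x \<in> V \<and> V \<subseteq> U"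
    using metrizable_separable_imp_second_countable[OF M] by (auto simp: second_countable_def)
  have "\<exists>N\<in>image f ` \<B>. y \<in> N \<and> N \<subseteq> U" if U: "open U" "y \<in> S \<inter> U" for U y
  proof -
    have "openin M {x \<in> topspace M. f x \<in> S \<inter> U}"
      using f(1) U(1) by (intro openin_continuous_map_preimage) auto
    moreover obtain x where "x \<in> topspace M" "y = f x" using f(2) U(2) by blast
    ultimately obtain V where "V \<in> \<B>" "x \<in> V" "V \<subseteq> {x \<in> topspace M. f x \<in> S \<inter> U}"
      using base[of _ x] U(2) by blast
    then show ?thesis using \<open>y = f x\<close> by blast
  qed
  then show ?thesis
    unfolding countable_network_def using \<B> by (intro exI[of _ "image f ` \<B>"]) blast
qed

text \<open>Hausdorff separation of pairs of network elements already generates a coarser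
  Hausdorff topology, which by compactness is the given one.\<close>

lemma compact_countable_network_base:
  fixes S :: "'a::t2_space set"
  assumes "compact S" "countable_network S"
  shows "\<exists>\<B>. countable \<B> \<and> (\<forall>B\<in>\<B>. open B) \<and>
    (\<forall>U x. open U \<longrightarrow> x \<in> S \<inter> U \<longrightarrow> (\<exists>B\<in>\<B>. x \<in> B \<and> B \<inter> S \<subseteq> U))"
proof -
  obtain \<N> where \<N>: "countable \<N>"
      "\<And>U x. open U \<Longrightarrow> x \<in> S \<inter> U \<Longrightarrow> \<exists>N\<in>\<N>. x \<in> N \<and> N \<subseteq> U"
    using assms(2) unfolding countable_network_def by blast
  define sep where "sep = (\<lambda>(P, Q) (O1, O2). open O1 \<and> open O2 \<and> O1 \<inter> O2 = {} \<and>
      P \<subseteq> O1 \<and> Q \<subseteq> (O2 :: 'a set))"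
  \<comment> \<open>One choice of disjoint open sets for each separable pair of network members,
    hence countably many in all.\<close>
  define s where "s p = (SOME q. sep p q)" for p
  define J where "J = {p \<in> \<N> \<times> \<N>. \<exists>q. sep p q}"
  have s: "sep p (s p)" if "p \<in> J" for p
    using that unfolding J_def s_def by (auto intro: someI_ex)
  have os: "open (fst (s p))" "open (snd (s p))" "fst (s p) \<inter> snd (s p) = {}"
    "fst p \<subseteq> fst (s p)" "snd p \<subseteq> snd (s p)" if "p \<in> J" for p
    using s[OF that] by (simp_all add: sep_def split_beta)
  \<comment> \<open>The empty intersection is the whole space; it serves when \<open>S\<close> lies
    in \<open>U\<close>.\<close>
  define \<B> where "\<B> = (\<lambda>F. \<Inter>p\<in>F. fst (s p)) ` {F. finite F \<and> F \<subseteq> J}"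
  show ?thesis
  proof (intro exI[of _ \<B>] conjI allI impI ballI)
    have "countable J"
      by (rule countable_subset[of _ "\<N> \<times> \<N>"]) (auto simp: J_def \<N>)
    then show "countable \<B>"
      unfolding \<B>_def using countable_Collect_finite_subset by (auto simp: conj_commute)
    show "open B" if "B \<in> \<B>" for B
      using that os(1) unfolding \<B>_def by (auto intro!: open_INT)
    fix U x assume U: "open U" "x \<in> S \<inter> U"
    have "\<exists>p\<in>J. x \<in> fst (s p) \<and> y \<in> snd (s p)" if y: "y \<in> S - U" for y
    proof -
      obtain O1 O2 where O: "open O1" "open O2" "x \<in> O1" "y \<in> O2" "O1 \<inter> O2 = {}"
        using hausdorff[of x y] U y by blast
      obtain P Q where PQ: "P \<in> \<N>" "x \<in> P" "P \<subseteq> O1" "Q \<in> \<N>" "y \<in> Q" "Q \<subseteq> O2"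
        using \<N>(2)[of O1 x] \<N>(2)[of O2 y] O U y by blast
      have "sep (P, Q) (O1, O2)" using O PQ by (simp add: sep_def)
      then have "(P, Q) \<in> J" using PQ by (auto simp: J_def)
      then show ?thesis
        using os(4,5)[of "(P, Q)"] PQ by (intro bexI[of _ "(P, Q)"]) auto
    qed
    then obtain p where p: "\<And>y. y \<in> S - U \<Longrightarrow> p y \<in> J \<and> x \<in> fst (s (p y)) \<and> y \<in> snd (s (p y))"
      by metis
    have op: "open (snd (s (p y)))" if "y \<in> S - U" for y
      using p[OF that] os(2) by blast
    \<comment> \<open>Finitely many second neighbourhoods cover \<open>S - U\<close>; the matching
      first ones intersect in a set around \<open>x\<close> that misses them all.\<close>
    have cpt: "compact (S - U)" using assms(1) U(1) by (rule compact_diff)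
    have cov: "S - U \<subseteq> (\<Union>y\<in>S - U. snd (s (p y)))" using p by blast
    obtain F where F: "F \<subseteq> S - U" "finite F" "S - U \<subseteq> (\<Union>y\<in>F. snd (s (p y)))"
      by (rule compactE_image[OF cpt op cov])
    define B where "B = (\<Inter>q\<in>p ` F. fst (s q))"
    have "B \<in> \<B>" unfolding \<B>_def B_def using F p by blast
    moreover have "x \<in> B" using F p by (auto simp: B_def)
    moreover have "B \<inter> S \<subseteq> U"
    proof (rule ccontr)
      assume "\<not> B \<inter> S \<subseteq> U"
      then obtain z y where "z \<in> B" "y \<in> F" "z \<in> snd (s (p y))" using F by blast
      moreover then have "z \<in> fst (s (p y))" by (auto simp: B_def)
      ultimately show False using os(3)[of "p y"] p F by blast
    qed
    ultimately show "\<exists>B\<in>\<B>. x \<in> B \<and> B \<inter> S \<subseteq> U" by blast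
  qed
qed

section \<open>Grids and covering dimension\<close>

text \<open>Grid points are arbitrary sequences, of which only the coordinates \<open>i < m\<close> matter, truncated
  at \<open>N\<close>: no finiteness bookkeeping is needed for products.\<close>

definition grid_essential ::
  "nat \<Rightarrow> 'a::topological_space set \<Rightarrow> (nat \<Rightarrow> 'a set) \<Rightarrow> (nat \<Rightarrow> 'a set) \<Rightarrow> bool" where
  "grid_essential m K A B \<longleftrightarrow>
     (\<forall>\<U>. (\<forall>U\<in>\<U>. open U) \<and> K \<subseteq> \<Union>\<U> \<longrightarrow>
        (\<exists>N \<phi>. 0 < N \<and> (\<forall>x. \<phi> x \<in> K) \<and>
           (\<forall>x. \<forall>i<m. (x i = 0 \<longrightarrow> \<phi> x \<in> A i) \<and> (N \<le> x i \<longrightarrow> \<phi> x \<in> B i)) \<and>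
           (\<forall>q. \<exists>U\<in>\<U>. \<forall>x. (\<forall>i<m. q i \<le> x i \<and> x i \<le> q i + 1) \<longrightarrow> \<phi> (x :: nat \<Rightarrow> nat) \<in> U)))"

lemma grid_essentialD:
  assumes "grid_essential m K A B" "\<forall>U\<in>\<U>. open U" "K \<subseteq> \<Union>\<U>"
  shows "\<exists>N \<phi>. 0 < N \<and> (\<forall>x. \<phi> x \<in> K) \<and>
    (\<forall>x. \<forall>i<m. (x i = 0 \<longrightarrow> \<phi> x \<in> A i) \<and> (N \<le> x i \<longrightarrow> \<phi> x \<in> B i)) \<and>
    (\<forall>q. \<exists>U\<in>\<U>. \<forall>x. (\<forall>i<m. q i \<le> x i \<and> x i \<le> q i + 1) \<longrightarrow> \<phi> (x :: nat \<Rightarrow> nat) \<in> U)"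
  using assms unfolding grid_essential_def by blast

lemma grid_essential_0: "k \<in> K \<Longrightarrow> grid_essential 0 K A B"
  unfolding grid_essential_def by (intro allI impI exI[of _ 1] exI[of _ "\<lambda>_. k"]) auto

text \<open>The cover is pulled back along \<open>f\<close>, and a grid map for the pullback is
  composed with \<open>f\<close>. Disjointness of opposite faces is not part of
  \<open>grid_essential\<close>; it may be lost here and is secured separately.\<close>

lemma grid_essential_image:
  assumes ess: "grid_essential m K A B" and f: "continuous_on K f"
  shows "grid_essential m (f ` K) (\<lambda>i. f ` A i) (\<lambda>i. f ` B i)"
  unfolding grid_essential_def
proof (intro allI impI, elim conjE)
  fix \<U> assume \<U>: "\<forall>U\<in>\<U>. open U" "f ` K \<subseteq> \<Union>\<U>"
  \<comment> \<open>As \<open>f\<close> is continuous only on \<open>K\<close>, preimages are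
    replaced by open sets with the same trace on \<open>K\<close>.\<close>
  define \<V> where "\<V> = {V. open V \<and> (\<exists>U\<in>\<U>. V \<inter> K = f -` U \<inter> K)}"
  have cov: "K \<subseteq> \<Union>\<V>"
  proof
    fix k assume k: "k \<in> K"
    then obtain U where U: "U \<in> \<U>" "f k \<in> U" using \<U> by blast
    then have "open U" using \<U>(1) by blast
    then obtain V where "open V" "V \<inter> K = f -` U \<inter> K"
      using f unfolding continuous_on_open_invariant by blast
    then show "k \<in> \<Union>\<V>" using k U unfolding \<V>_def by blast
  qed
  have op: "\<forall>V\<in>\<V>. open V" by (simp add: \<V>_def)
  obtain N \<phi> where "0 < N" "\<forall>x. \<phi> x \<in> K"
    "\<forall>x. \<forall>i<m. (x i = 0 \<longrightarrow> \<phi> x \<in> A i) \<and> (N \<le> x i \<longrightarrow> \<phi> x \<in> B i)"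
    and cell: "\<forall>q. \<exists>U\<in>\<V>. \<forall>x. (\<forall>i<m. q i \<le> x i \<and> x i \<le> q i + 1) \<longrightarrow> \<phi> (x :: nat \<Rightarrow> nat) \<in> U"
    using grid_essentialD[OF ess op cov] by (elim exE conjE) (rule that)
  then have \<phi>: "0 < N" "\<And>x. \<phi> x \<in> K"
    "\<And>x i. i < m \<Longrightarrow> x i = 0 \<Longrightarrow> \<phi> x \<in> A i"
    "\<And>x i. i < m \<Longrightarrow> N \<le> x i \<Longrightarrow> \<phi> x \<in> B i"
    by simp_all
  have "\<exists>U\<in>\<U>. \<forall>x. (\<forall>i<m. q i \<le> x i \<and> x i \<le> q i + 1) \<longrightarrow> (f \<circ> \<phi>) x \<in> U" for q
  proof -
    obtain V U where V: "\<forall>x. (\<forall>i<m. q i \<le> x i \<and> x i \<le> q i + 1) \<longrightarrow> \<phi> x \<in> V"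
        "U \<in> \<U>" "V \<inter> K = f -` U \<inter> K"
      using cell[rule_format, of q] unfolding \<V>_def by blast
    have "f (\<phi> x) \<in> U" if "\<forall>i<m. q i \<le> x i \<and> x i \<le> q i + 1" for x
      using V \<phi>(2)[of x] that by blast
    then show ?thesis using V by auto
  qed
  then show "\<exists>N \<phi>. 0 < N \<and> (\<forall>x. \<phi> x \<in> f ` K) \<and>
           (\<forall>x. \<forall>i<m. (x i = 0 \<longrightarrow> \<phi> x \<in> f ` A i) \<and> (N \<le> x i \<longrightarrow> \<phi> x \<in> f ` B i)) \<and>
           (\<forall>q. \<exists>U\<in>\<U>. \<forall>x. (\<forall>i<m. q i \<le> x i \<and> x i \<le> q i + 1) \<longrightarrow> \<phi> (x :: nat \<Rightarrow> nat) \<in> U)"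
    using \<phi> by (intro exI[of _ N] exI[of _ "f \<circ> \<phi>"]) auto
qed

section \<open>Chains in continua and products of grids\<close>

text \<open>Being joined by a finite chain is an equivalence relation with open classes, so
  connectedness leaves one class. The chain is an infinite sequence with constant tail, to be
  indexed by an unbounded grid coordinate.\<close>

lemma connected_chain:
  assumes "connected S" "a \<in> S" "b \<in> S"
    and \<Q>: "\<forall>Q\<in>\<Q>. open Q" "S \<subseteq> \<Union>\<Q>"
  shows "\<exists>(M::nat) c. c 0 = a \<and> (\<forall>j\<ge>M. c j = b) \<and> (\<forall>j. c j \<in> S) \<and>
    (\<forall>j. \<exists>Q\<in>\<Q>. c j \<in> Q \<and> c (Suc j) \<in> Q)"
proof -
  define R where "R = (\<lambda>x y. x \<in> S \<and> y \<in> S \<and> (\<exists>Q\<in>\<Q>. x \<in> Q \<and> y \<in> Q))"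
  have "R\<^sup>*\<^sup>* a b"
  proof (rule connected_equivalence_relation[OF assms(1-3)])
    have "symp R" by (auto simp: symp_def R_def)
    then show "R\<^sup>*\<^sup>* y x" if "R\<^sup>*\<^sup>* x y" for x y
      using that by (rule sympD[OF symp_rtranclp])
    show "R\<^sup>*\<^sup>* x z" if "R\<^sup>*\<^sup>* x y" "R\<^sup>*\<^sup>* y z" for x y z
      using that by simp
    fix t assume t: "t \<in> S"
    then obtain Q where Q: "Q \<in> \<Q>" "t \<in> Q" using \<Q> by blast
    then have "\<forall>y\<in>S \<inter> Q. R\<^sup>*\<^sup>* t y" using t by (auto simp: R_def)
    then show "\<exists>T. openin (top_of_set S) T \<and> t \<in> T \<and> (\<forall>x\<in>T. R\<^sup>*\<^sup>* t x)"
      using Q t \<Q>(1) by (intro exI[of _ "S \<inter> Q"]) (auto simp: openin_open_Int)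
  qed
  then show ?thesis
  proof (induction rule: rtranclp_induct)
    case base
    then show ?case using \<Q> assms(2) by (intro exI[of _ 0] exI[of _ "\<lambda>_. a"]) auto
  next
    case (step y z)
    then obtain M c where c: "c 0 = a" "\<forall>j\<ge>M. c j = y" "\<forall>j. c j \<in> S"
      "\<forall>j::nat. \<exists>Q\<in>\<Q>. c j \<in> Q \<and> c (Suc j) \<in> Q" by blast
    have z: "z \<in> S" "\<exists>Q\<in>\<Q>. y \<in> Q \<and> z \<in> Q" using step by (auto simp: R_def)
    \<comment> \<open>The tail at \<open>y\<close> beyond \<open>M\<close> becomes \<open>z\<close>;
      the only nontrivial new link is the one at \<open>j = M\<close>.\<close>
    define c' where "c' j = (if j \<le> M then c j else z)" for j
    have "\<exists>Q\<in>\<Q>. c' j \<in> Q \<and> c' (Suc j) \<in> Q" for j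
    proof (cases "j < M")
      case True then show ?thesis using c by (simp add: c'_def)
    next
      case False
      then show ?thesis using z c(2) by (cases "j = M") (auto simp: c'_def)
    qed
    then show ?case using c z by (intro exI[of _ "Suc M"] exI[of _ c']) (auto simp: c'_def)
  qed
qed

text \<open>The tube lemma used twice: compactness of \<open>C\<close> gives one neighbourhood of
  \<open>k\<close> that serves all \<open>c\<close>, then compactness of \<open>K\<close> leaves
  finitely many of these, and sets around \<open>c\<close> can be shrunk to suit all of them. The
  two covers are thus independent of each other, as a product grid requires.\<close>

lemma tube_refinement:
  fixes \<U> :: "('a::topological_space \<times> 'b::topological_space) set set"
  assumes K: "compact K" and C: "compact C"
    and \<U>: "\<forall>U\<in>\<U>. open U" "K \<times> C \<subseteq> \<Union>\<U>"
  shows "\<exists>\<O> \<Q>. (\<forall>P\<in>\<O>. open P) \<and> K \<subseteq> \<Union>\<O> \<and> (\<forall>Q\<in>\<Q>. open Q) \<and> C \<subseteq> \<Union>\<Q> \<and>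
    (\<forall>P\<in>\<O>. \<forall>Q\<in>\<Q>. \<exists>U\<in>\<U>. P \<times> Q \<subseteq> U)"
proof -
  define good where "good P Q \<longleftrightarrow> open P \<and> open Q \<and> (\<exists>U\<in>\<U>. P \<times> Q \<subseteq> U)"
    for P :: "'a set" and Q :: "'b set"
  have box: "\<exists>P Q. k \<in> P \<and> c \<in> Q \<and> good P Q" if kc: "k \<in> K" "c \<in> C" for k c
  proof -
    obtain U where U: "U \<in> \<U>" "(k, c) \<in> U" using \<U>(2) kc by blast
    obtain P Q where "open P" "open Q" "(k, c) \<in> P \<times> Q" "P \<times> Q \<subseteq> U"
      by (rule open_prod_elim[OF \<U>(1)[rule_format, OF U(1)] U(2)])
    then have "good P Q" using U unfolding good_def by blast
    then show ?thesis using \<open>(k, c) \<in> P \<times> Q\<close> by blast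
  qed
  have "\<exists>P. open P \<and> k \<in> P \<and> (\<forall>c\<in>C. \<exists>Q. c \<in> Q \<and> good P Q)" if k: "k \<in> K" for k
  proof -
    obtain P Q where PQ: "\<And>c. c \<in> C \<Longrightarrow> k \<in> P c \<and> c \<in> Q c \<and> good (P c) (Q c)"
      using box[OF k] by metis
    have op: "\<And>c. c \<in> C \<Longrightarrow> open (Q c)" and cov: "C \<subseteq> (\<Union>c\<in>C. Q c)"
      using PQ by (auto simp: good_def)
    obtain D where D: "D \<subseteq> C" "finite D" "C \<subseteq> (\<Union>c\<in>D. Q c)"
      by (rule compactE_image[OF C op cov])
    define P' where "P' = (\<Inter>c\<in>D. P c)"
    have P': "open P'" using D PQ unfolding P'_def good_def by (intro open_INT) auto
    have "\<exists>Q. c \<in> Q \<and> good P' Q" if c: "c \<in> C" for c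
    proof -
      obtain d where d: "d \<in> D" "c \<in> Q d" using D c by blast
      then have "P' \<times> Q d \<subseteq> P d \<times> Q d" by (auto simp: P'_def)
      then have "good P' (Q d)"
        using P' PQ[of d] d D unfolding good_def by blast
      then show ?thesis using d by blast
    qed
    then show ?thesis using P' D PQ by (intro exI[of _ P']) (auto simp: P'_def)
  qed
  then obtain P where P: "\<And>k. k \<in> K \<Longrightarrow> open (P k) \<and> k \<in> P k \<and> (\<forall>c\<in>C. \<exists>Q. c \<in> Q \<and> good (P k) Q)"
    by metis
  have op: "\<And>k. k \<in> K \<Longrightarrow> open (P k)" and cov: "K \<subseteq> (\<Union>k\<in>K. P k)"
    using P by blast+
  obtain D where D: "D \<subseteq> K" "finite D" "K \<subseteq> (\<Union>k\<in>D. P k)"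
    by (rule compactE_image[OF K op cov])
  \<comment> \<open>These sets suit all of the finitely many \<open>P k\<close> at once, though with
    different members of \<open>\<U>\<close>.\<close>
  define \<Q> where "\<Q> = {Q. open Q \<and> (\<forall>k\<in>D. \<exists>U\<in>\<U>. P k \<times> Q \<subseteq> U)}"
  have "C \<subseteq> \<Union>\<Q>"
  proof
    fix c assume c: "c \<in> C"
    then have "\<forall>k\<in>D. \<exists>Q. c \<in> Q \<and> good (P k) Q" using P D(1) by blast
    then obtain Q where Q: "\<And>k. k \<in> D \<Longrightarrow> c \<in> Q k \<and> good (P k) (Q k)"
      by metis
    define Q' where "Q' = (\<Inter>k\<in>D. Q k)"
    have "open Q'" using D Q unfolding Q'_def good_def by (intro open_INT) auto
    moreover have "\<exists>U\<in>\<U>. P k \<times> Q' \<subseteq> U" if k: "k \<in> D" for k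
    proof -
      have "P k \<times> Q' \<subseteq> P k \<times> Q k" using k by (auto simp: Q'_def)
      then show ?thesis using Q[OF k] unfolding good_def by blast
    qed
    moreover have "c \<in> Q'" using Q by (auto simp: Q'_def)
    ultimately show "c \<in> \<Union>\<Q>" by (auto simp: \<Q>_def)
  qed
  moreover have "open T" if "T \<in> P ` D" for T using that op D(1) by blast
  moreover have "open Q" if "Q \<in> \<Q>" for Q using that by (simp add: \<Q>_def)
  moreover have "\<exists>U\<in>\<U>. T \<times> Q \<subseteq> U" if "T \<in> P ` D" "Q \<in> \<Q>" for T Q
    using that by (auto simp: \<Q>_def)
  ultimately show ?thesis using D(3) by (intro exI[of _ "P ` D"] exI[of _ \<Q>]) auto
qed

text \<open>The new coordinate moves along a chain from \<open>a\<close> to \<open>b\<close> in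
  \<open>C\<close>. Grid maps only have to send cells into members of the cover, so chains in a
  continuum can take the place of paths.\<close>

lemma grid_essential_Times:
  assumes ess: "grid_essential m K A B" and K: "compact K"
    and C: "compact C" "connected C" "a \<in> C" "b \<in> C"
  shows "grid_essential (Suc m) (K \<times> C) (\<lambda>i. if i < m then A i \<times> C else K \<times> {a})
           (\<lambda>i. if i < m then B i \<times> C else K \<times> {b})"
  unfolding grid_essential_def
proof (intro allI impI, elim conjE)
  fix \<U> :: "('a \<times> 'b) set set"
  assume \<U>: "\<forall>U\<in>\<U>. open U" "K \<times> C \<subseteq> \<Union>\<U>"
  obtain \<O> \<Q> where \<O>: "\<forall>P\<in>\<O>. open P" "K \<subseteq> \<Union>\<O>"
    and \<Q>: "\<forall>Q\<in>\<Q>. open Q" "C \<subseteq> \<Union>\<Q>"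
    and sub: "\<forall>P\<in>\<O>. \<forall>Q\<in>\<Q>. \<exists>U\<in>\<U>. P \<times> Q \<subseteq> U"
    using tube_refinement[OF K C(1) \<U>] by (elim exE conjE) (rule that)
  obtain N \<phi> where "0 < N" "\<forall>x. \<phi> x \<in> K"
    "\<forall>x. \<forall>i<m. (x i = 0 \<longrightarrow> \<phi> x \<in> A i) \<and> (N \<le> x i \<longrightarrow> \<phi> x \<in> B i)"
    and cell: "\<forall>q. \<exists>U\<in>\<O>. \<forall>x. (\<forall>i<m. q i \<le> x i \<and> x i \<le> q i + 1) \<longrightarrow> \<phi> (x :: nat \<Rightarrow> nat) \<in> U"
    using grid_essentialD[OF ess \<O>] by (elim exE conjE) (rule that)
  then have \<phi>: "0 < N" "\<And>x. \<phi> x \<in> K"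
    "\<And>x i. i < m \<Longrightarrow> x i = 0 \<Longrightarrow> \<phi> x \<in> A i"
    "\<And>x i. i < m \<Longrightarrow> N \<le> x i \<Longrightarrow> \<phi> x \<in> B i"
    by simp_all
  obtain M c where c: "c 0 = a" "\<forall>j\<ge>M::nat. c j = b" "\<forall>j. c j \<in> C"
    and step: "\<forall>j. \<exists>Q\<in>\<Q>. c j \<in> Q \<and> c (Suc j) \<in> Q"
    using connected_chain[OF C(2-4) \<Q>] by (elim exE conjE) (rule that)
  define \<psi> where "\<psi> x = (\<phi> x, c (x m))" for x
  have "\<exists>U\<in>\<U>. \<forall>x. (\<forall>i<Suc m. q i \<le> x i \<and> x i \<le> q i + 1) \<longrightarrow> \<psi> x \<in> U" for q
  proof -
    obtain P where P: "P \<in> \<O>" "\<forall>x. (\<forall>i<m. q i \<le> x i \<and> x i \<le> q i + 1) \<longrightarrow> \<phi> x \<in> P"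
      using cell[rule_format, of q] by (elim bexE)
    obtain Q where Q: "Q \<in> \<Q>" "c (q m) \<in> Q" "c (Suc (q m)) \<in> Q"
      using step[rule_format, of "q m"] by blast
    obtain U where U: "U \<in> \<U>" "P \<times> Q \<subseteq> U" using sub P Q by blast
    have "\<psi> x \<in> U" if x: "\<forall>i<Suc m. q i \<le> x i \<and> x i \<le> q i + 1" for x
    proof -
      \<comment> \<open>In the new direction a cell sees two consecutive points of the chain, and
        both lie in \<open>Q\<close>.\<close>
      have "x m = q m \<or> x m = Suc (q m)" using x by (auto simp: le_Suc_eq)
      then have "c (x m) \<in> Q" using Q by auto
      moreover have "\<phi> x \<in> P" using P x by simp
      ultimately show ?thesis using U by (auto simp: \<psi>_def)
    qed
    then show ?thesis using U by blast
  qed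
  moreover have "\<forall>x. \<psi> x \<in> K \<times> C" using \<phi> c by (auto simp: \<psi>_def)
  ultimately show "\<exists>N \<phi>. 0 < N \<and> (\<forall>x. \<phi> x \<in> K \<times> C) \<and>
           (\<forall>x. \<forall>i<Suc m. (x i = 0 \<longrightarrow> \<phi> x \<in> (if i < m then A i \<times> C else K \<times> {a})) \<and>
              (N \<le> x i \<longrightarrow> \<phi> x \<in> (if i < m then B i \<times> C else K \<times> {b}))) \<and>
           (\<forall>q. \<exists>U\<in>\<U>. \<forall>x. (\<forall>i<Suc m. q i \<le> x i \<and> x i \<le> q i + 1) \<longrightarrow> \<phi> (x :: nat \<Rightarrow> nat) \<in> U)"
    \<comment> \<open>Far faces are prescribed for all \<open>x i\<close> from \<open>N\<close> on,
      so \<open>N\<close> may be enlarged until the chain has reached \<open>b\<close> as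
      well.\<close>
    using \<phi> c by (intro exI[of _ "max N M"] exI[of _ \<psi>]) (auto simp: \<psi>_def less_Suc_eq)
qed

section \<open>Coloured refinements and the lower bound for the dimension\<close>

lemma Hausdorff_space_euclidean_t2: "Hausdorff_space (euclidean :: 'a::t2_space topology)"
  unfolding Hausdorff_space_def disjnt_def by (metis hausdorff open_openin)

text \<open>Each point gets a Urysohn function vanishing off a member of the cover; compactness
  leaves finitely many, and those attached to the same member are added up. For sets outside the
  cover the sum is empty.\<close>

lemma bump_functions:
  assumes X: "compact_space X" "Hausdorff_space X"
    and \<V>: "\<And>V. V \<in> \<V> \<Longrightarrow> openin X V" "topspace X \<subseteq> \<Union>\<V>"
  shows "\<exists>p :: 'a set \<Rightarrow> 'a \<Rightarrow> real. (\<forall>V. continuous_map X euclideanreal (p V)) \<and>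
    (\<forall>x\<in>topspace X. (\<forall>V. x \<notin> V \<longrightarrow> p V x = 0) \<and> (\<exists>V\<in>\<V>. 0 < p V x))"
proof -
  have norm: "normal_space X"
    using X compact_Hausdorff_or_regular_imp_normal_space by blast
  have "\<exists>V h. V \<in> \<V> \<and> continuous_map X euclideanreal h \<and> h x = 1 \<and> (\<forall>y\<in>topspace X - V. h y = 0)"
    if x: "x \<in> topspace X" for x
  proof -
    obtain V where V: "V \<in> \<V>" "x \<in> V" using \<V> x by blast
    have 1: "closedin X {x}" using X x by (simp add: closedin_Hausdorff_singleton)
    have 2: "closedin X (topspace X - V)" using \<V> V by blast
    have 3: "disjnt {x} (topspace X - V)" using V by simp
    obtain h where "continuous_map X euclideanreal h" "h ` {x} \<subseteq> {1}" "h ` (topspace X - V) \<subseteq> {0}"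
      by (rule Urysohn_lemma_alt[OF norm 1 2 3])
    then show ?thesis using V by (intro exI[of _ V] exI[of _ h]) auto
  qed
  then obtain V h where Vh: "\<forall>x\<in>topspace X. V x \<in> \<V> \<and> continuous_map X euclideanreal (h x) \<and>
      h x x = 1 \<and> (\<forall>y\<in>topspace X - V x. h x y = 0)"
    by metis
  define W where "W x = {y \<in> topspace X. h x y \<in> {0<..}}" for x :: 'a
  have W: "openin X (W x)" if "x \<in> topspace X" for x
    unfolding W_def using Vh that by (intro openin_continuous_map_preimage) auto
  have Wx: "x \<in> W x" if "x \<in> topspace X" for x
    using Vh that by (auto simp: W_def)
  have "\<forall>U\<in>W ` topspace X. openin X U" "topspace X \<subseteq> \<Union>(W ` topspace X)"
    using W Wx by auto
  then obtain \<F> where "finite \<F>" "\<F> \<subseteq> W ` topspace X" "topspace X \<subseteq> \<Union>\<F>"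
    using X(1) unfolding compact_space_alt by meson
  then obtain D where D: "finite D" "D \<subseteq> topspace X" "topspace X \<subseteq> (\<Union>x\<in>D. W x)"
    by (metis finite_subset_image)
  \<comment> \<open>The truncation \<open>max 0\<close> is there because the Urysohn functions may
    take negative values.\<close>
  define p where "p U y = (\<Sum>x | x \<in> D \<and> V x = U. max 0 (h x y))" for U y
  show ?thesis
  proof (intro exI[of _ p] conjI allI ballI impI)
    show "continuous_map X euclideanreal (p U)" for U
      unfolding p_def using D Vh
      by (intro continuous_map_sum continuous_map_real_max) (auto simp: subset_iff)
    show "p U x = 0" if "x \<in> topspace X" "x \<notin> U" for U x
      unfolding p_def using D Vh that by (intro sum.neutral) fastforce
    show "\<exists>U\<in>\<V>. 0 < p U y" if y: "y \<in> topspace X" for y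
    proof -
      obtain x where x: "x \<in> D" "y \<in> W x" using D y by blast
      have "0 < p (V x) y"
        unfolding p_def using x D by (intro sum_pos2[of _ x]) (auto simp: W_def)
      then show ?thesis using x D Vh by blast
    qed
  qed
qed

text \<open>Ostrand's theorem: group the points by the set of members of the cover at which the bump
  functions are maximal, as in a barycentric subdivision of the nerve. Points with maximisers
  \<open>S\<close> get colour \<open>card S - 1\<close>.\<close>

lemma colored_refinement:
  assumes X: "compact_space X" "Hausdorff_space X"
    and \<V>: "finite \<V>" "\<forall>V\<in>\<V>. openin X V" "topspace X \<subseteq> \<Union>\<V>"
    and ord: "\<forall>x\<in>topspace X. card {V \<in> \<V>. x \<in> V} \<le> n"
  shows "\<exists>\<C> :: nat \<Rightarrow> 'a set set. (\<forall>j. pairwise disjnt (\<C> j) \<and>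
      (\<forall>U\<in>\<C> j. openin X U \<and> (\<exists>V\<in>\<V>. U \<subseteq> V))) \<and> topspace X \<subseteq> (\<Union>j<n. \<Union>(\<C> j))"
proof -
  obtain p :: "'a set \<Rightarrow> 'a \<Rightarrow> real" where
    p: "\<And>V. continuous_map X euclideanreal (p V)"
    "\<And>V x. x \<in> topspace X \<Longrightarrow> x \<notin> V \<Longrightarrow> p V x = 0"
    "\<And>x. x \<in> topspace X \<Longrightarrow> \<exists>V\<in>\<V>. 0 < p V x"
    using bump_functions[OF X, of \<V>] \<V>(2,3) by blast
  define cell where "cell S = {x \<in> topspace X. (\<forall>V\<in>S. 0 < p V x) \<and> (\<forall>V\<in>S. \<forall>U\<in>\<V> - S. p U x < p V x)}" for S
  \<comment> \<open>Using \<open>Suc j\<close> excludes the empty \<open>S\<close>, whose cell would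
    be the whole space.\<close>
  define \<C> where "\<C> j = cell ` {S. S \<subseteq> \<V> \<and> card S = Suc j}" for j
  have open_cell: "openin X (cell S)" if S: "S \<subseteq> \<V>" for S
  proof -
    have fin: "finite S" using S \<V>(1) finite_subset by blast
    have 1: "openin X {x \<in> topspace X. 0 < p V x}" for V
      using openin_continuous_map_preimage[OF p(1), of "{0<..}" V] by simp
    have 2: "openin X {x \<in> topspace X. p U x < p V x}" for U V
    proof -
      have "continuous_map X euclideanreal (\<lambda>x. p V x - p U x)"
        by (intro continuous_intros p)
      from openin_continuous_map_preimage[OF this, of "{0<..}"] show ?thesis by simp
    qed
    have "cell S = topspace X \<inter> \<Inter>((\<lambda>V. {x \<in> topspace X. 0 < p V x}) ` S \<union>
        (\<lambda>(V, U). {x \<in> topspace X. p U x < p V x}) ` (S \<times> (\<V> - S)))"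
      unfolding cell_def by auto
    moreover have "openin X \<dots>"
      using 1 2 fin \<V>(1) by (intro openin_Int_Inter) auto
    ultimately show ?thesis by simp
  qed
  show ?thesis
  proof (intro exI[of _ \<C>] conjI allI ballI)
    show "openin X U" if "U \<in> \<C> j" for j U
      using that open_cell by (auto simp: \<C>_def)
    show "pairwise disjnt (\<C> j)" for j
    proof (rule pairwiseI)
      fix U U' assume U: "U \<in> \<C> j" "U' \<in> \<C> j" "U \<noteq> U'"
      obtain S where S: "U = cell S" "S \<subseteq> \<V>" "card S = Suc j"
        using U(1) by (auto simp: \<C>_def)
      obtain T where T: "U' = cell T" "T \<subseteq> \<V>" "card T = Suc j"
        using U(2) by (auto simp: \<C>_def)
      have ST: "U = cell S" "U' = cell T" "S \<subseteq> \<V>" "T \<subseteq> \<V>" "card S = card T" "S \<noteq> T"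
        using S T U(3) by auto
      have "finite S" "finite T" using ST(3,4) \<V>(1) by (auto intro: finite_subset)
      \<comment> \<open>Distinct finite sets of equal size are incomparable; a member of each
        outside the other gives contradictory inequalities.\<close>
      then have "\<not> S \<subseteq> T" "\<not> T \<subseteq> S"
        using ST(5,6) card_subset_eq[of T S] card_subset_eq[of S T] by auto
      then obtain V W where VW: "V \<in> S" "V \<notin> T" "W \<in> T" "W \<notin> S" by blast
      have False if x: "x \<in> cell S" "x \<in> cell T" for x
      proof -
        have "p W x < p V x" "p V x < p W x"
          using x VW ST unfolding cell_def by blast+
        then show False by simp
      qed
      then show "disjnt U U'" using ST by (auto simp: disjnt_def)
    qed
    show "\<exists>V\<in>\<V>. U \<subseteq> V" if U: "U \<in> \<C> j" for j U
    proof -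
      obtain S where S: "U = cell S" "S \<subseteq> \<V>" "card S = Suc j"
        using U by (auto simp: \<C>_def)
      then obtain V where V: "V \<in> S" by fastforce
      have "x \<in> V" if "x \<in> cell S" for x
        using that V S(2) p(2)[of x V] unfolding cell_def by force
      then show ?thesis using V S by blast
    qed
    show "topspace X \<subseteq> (\<Union>j<n. \<Union>(\<C> j))"
    proof
      fix x assume x: "x \<in> topspace X"
      define m where "m = Max ((\<lambda>V. p V x) ` \<V>)"
      define S where "S = {V \<in> \<V>. p V x = m}"
      obtain V0 where V0: "V0 \<in> \<V>" "0 < p V0 x" using p(3)[OF x] by blast
      have le: "p V x \<le> m" if "V \<in> \<V>" for V using that \<V>(1) by (simp add: m_def)
      then have "0 < m" using V0 by force
      have "m \<in> (\<lambda>V. p V x) ` \<V>" unfolding m_def using V0 \<V>(1) by (intro Max_in) auto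
      then have "S \<noteq> {}" by (auto simp: S_def)
      moreover have "finite S" using \<V>(1) by (simp add: S_def)
      ultimately have card0: "0 < card S" by (simp add: card_gt_0_iff)
      \<comment> \<open>The maximum is positive, so all maximisers contain \<open>x\<close>, and the
        order of the cover bounds their number.\<close>
      have "S \<subseteq> {V \<in> \<V>. x \<in> V}" using \<open>0 < m\<close> p(2)[OF x] by (force simp: S_def)
      then have "card S \<le> card {V \<in> \<V>. x \<in> V}" using \<V>(1) by (intro card_mono) auto
      then have "card S \<le> n" using ord x by force
      have "x \<in> cell S"
        using x \<open>0 < m\<close> le by (force simp: cell_def S_def)
      moreover have "cell S \<in> \<C> (card S - 1)"
        using card0 unfolding \<C>_def by (intro imageI) (auto simp: S_def)
      moreover have "card S - 1 < n" using card0 \<open>card S \<le> n\<close> by simp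
      ultimately show "x \<in> (\<Union>j<n. \<Union>(\<C> j))" by blast
    qed
  qed
qed

text \<open>A dimension below \<open>n\<close> would give a cover in \<open>n\<close> colours whose
  members miss a face of each opposite pair. Colour \<open>i\<close> then yields a labelling in
  direction \<open>i\<close>, and Kuhn's lemma finds a cell on which all labels vary. But a fine
  cell lies in one member of the cover, which fixes one label.\<close>

lemma grid_essential_imp_not_covering_dim_le:
  fixes K :: "'a::t2_space set"
  assumes K: "compact K"
    and AB: "\<And>i. i < n \<Longrightarrow> closed (A i)" "\<And>i. i < n \<Longrightarrow> closed (B i)"
      "\<And>i. i < n \<Longrightarrow> A i \<inter> B i = {}"
    and ess: "grid_essential n K A B"
    and d: "d < int n"
  shows "\<not> covering_dim_le (top_of_set K) d"
proof
  assume dim: "covering_dim_le (top_of_set K) d"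
  \<comment> \<open>In the directions of \<open>\<sigma>\<close> the face \<open>A i\<close> is
    removed, in the others \<open>B i\<close>. A point \<open>x\<close> is covered through the
    \<open>\<sigma>\<close> of all directions with \<open>x\<close> outside
    \<open>A i\<close>.\<close>
  define \<U> where "\<U> = (\<lambda>\<sigma>. K - (\<Union>i\<in>\<sigma>. A i) - (\<Union>i\<in>{..<n} - \<sigma>. B i)) ` Pow {..<n}"
  have "finite \<U>" by (simp add: \<U>_def)
  moreover have "\<forall>U\<in>\<U>. openin (top_of_set K) U"
  proof
    fix U assume "U \<in> \<U>"
    then obtain \<sigma> where \<sigma>: "\<sigma> \<subseteq> {..<n}" "U = K - (\<Union>i\<in>\<sigma>. A i) - (\<Union>i\<in>{..<n} - \<sigma>. B i)"
      by (auto simp: \<U>_def)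
    then have fin: "finite \<sigma>" using finite_subset by blast
    have "closed ((\<Union>i\<in>\<sigma>. A i) \<union> (\<Union>i\<in>{..<n} - \<sigma>. B i))"
      using fin \<sigma> AB by (intro closed_Un closed_UN) auto
    then have "openin (top_of_set K) (K \<inter> - ((\<Union>i\<in>\<sigma>. A i) \<union> (\<Union>i\<in>{..<n} - \<sigma>. B i)))"
      by (intro openin_open_Int open_Compl)
    moreover have "U = K \<inter> - ((\<Union>i\<in>\<sigma>. A i) \<union> (\<Union>i\<in>{..<n} - \<sigma>. B i))"
      using \<sigma>(2) by blast
    ultimately show "openin (top_of_set K) U" by (simp only:)
  qed
  moreover have "\<Union>\<U> = topspace (top_of_set K)"
  proof -
    have "x \<in> \<Union>\<U>" if "x \<in> K" for x
      unfolding \<U>_def using that AB(3)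
      by (intro UnionI[of "K - (\<Union>i\<in>{i. i < n \<and> x \<notin> A i}. A i) -
            (\<Union>i\<in>{..<n} - {i. i < n \<and> x \<notin> A i}. B i)"] imageI) auto
    then show ?thesis by (auto simp: \<U>_def)
  qed
  ultimately have "\<exists>\<V>. finite \<V> \<and> (\<forall>V\<in>\<V>. openin (top_of_set K) V) \<and>
      \<Union>\<V> = topspace (top_of_set K) \<and> (\<forall>V\<in>\<V>. \<exists>U\<in>\<U>. V \<subseteq> U) \<and>
      (\<forall>x\<in>topspace (top_of_set K). int (card {V \<in> \<V>. x \<in> V}) \<le> d + 1)"
    using dim unfolding covering_dim_le_def by (elim allE[of _ \<U>] impE) (intro conjI)
  then obtain \<V> where \<V>: "finite \<V>" "\<forall>V\<in>\<V>. openin (top_of_set K) V"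
    "\<Union>\<V> = topspace (top_of_set K)" and ref: "\<forall>V\<in>\<V>. \<exists>U\<in>\<U>. V \<subseteq> U"
    and ord: "\<forall>x\<in>topspace (top_of_set K). int (card {V \<in> \<V>. x \<in> V}) \<le> d + 1"
    by (elim exE conjE) (rule that)
  have cpt: "compact_space (top_of_set K)" using K by (simp add: compact_space_subtopology)
  have haus: "Hausdorff_space (top_of_set K)"
    by (rule Hausdorff_space_subtopology[OF Hausdorff_space_euclidean_t2])
  have cov: "topspace (top_of_set K) \<subseteq> \<Union>\<V>" using \<V>(3) by (rule equalityD2)
  \<comment> \<open>The order is at most \<open>d + 1\<close>, hence at most \<open>n\<close>: as
    many colours as directions.\<close>
  have ord': "\<forall>x\<in>topspace (top_of_set K). card {V \<in> \<V>. x \<in> V} \<le> n"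
  proof
    fix x assume "x \<in> topspace (top_of_set K)"
    then show "card {V \<in> \<V>. x \<in> V} \<le> n" using bspec[OF ord] d by fastforce
  qed
  obtain \<C> where col: "\<forall>j. pairwise disjnt (\<C> j) \<and>
      (\<forall>U\<in>\<C> j. openin (top_of_set K) U \<and> (\<exists>V\<in>\<V>. U \<subseteq> V))"
    and covC: "topspace (top_of_set K) \<subseteq> (\<Union>j<n. \<Union>(\<C> j))"
    using colored_refinement[OF cpt haus \<V>(1) \<V>(2) cov ord']
    by (elim exE conjE) (rule that)
  have open_col: "openin (top_of_set K) U" and ref_col: "\<exists>V\<in>\<V>. U \<subseteq> V"
    if "U \<in> \<C> j" for j U
    using spec[OF col, of j] that by simp_all
  have disj_col: "pairwise disjnt (\<C> j)" for j using spec[OF col, of j] by simp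
  have miss: "U \<inter> A i = {} \<or> U \<inter> B i = {}" if U: "U \<in> \<C> j" and i: "i < n" for U i j
  proof -
    obtain V where V: "V \<in> \<V>" "U \<subseteq> V" using ref_col[OF U] by blast
    then obtain W where W: "W \<in> \<U>" "V \<subseteq> W" using ref by blast
    then obtain \<sigma> where "W = K - (\<Union>i\<in>\<sigma>. A i) - (\<Union>i\<in>{..<n} - \<sigma>. B i)"
      unfolding \<U>_def by blast
    then have \<sigma>: "U \<subseteq> K - (\<Union>i\<in>\<sigma>. A i) - (\<Union>i\<in>{..<n} - \<sigma>. B i)"
      using V W by simp
    show ?thesis
    proof (cases "i \<in> \<sigma>")
      case True then show ?thesis using \<sigma> by blast
    next
      case False then have "i \<in> {..<n} - \<sigma>" using i by simp
      then show ?thesis using \<sigma> by blast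
    qed
  qed
  \<comment> \<open>Colour \<open>i\<close> is used in direction \<open>i\<close> only:
    \<open>P i\<close> misses \<open>A i\<close>, while \<open>Q i\<close> misses both
    \<open>B i\<close> and \<open>P i\<close>.\<close>
  define P where "P i = \<Union>{U \<in> \<C> i. U \<inter> A i = {}}" for i
  define Q where "Q i = \<Union>{U \<in> \<C> i. U \<inter> A i \<noteq> {}}" for i
  have PA: "P i \<inter> A i = {}" for i by (auto simp: P_def)
  have QB: "Q i \<inter> B i = {}" if "i < n" for i
    using miss[OF _ that] by (force simp: Q_def)
  have PQ: "P i \<inter> Q i = {}" for i
    using disj_col[of i] unfolding P_def Q_def pairwise_def disjnt_def by blast
  have KPQ: "\<exists>i<n. x \<in> P i \<union> Q i" if "x \<in> K" for x
  proof -
    have "x \<in> (\<Union>j<n. \<Union>(\<C> j))" using covC that by (simp add: subset_iff)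
    then obtain i U where "i < n" "U \<in> \<C> i" "x \<in> U" by blast
    then have "x \<in> P i \<union> Q i" unfolding P_def Q_def by blast
    then show ?thesis using \<open>i < n\<close> by blast
  qed
  have "openin (top_of_set K) (P i)" "openin (top_of_set K) (Q i)" for i
    unfolding P_def Q_def using open_col by (auto intro!: openin_Union)
  then obtain P' Q' where P': "\<And>i. open (P' i)" "\<And>i. P i = K \<inter> P' i"
    and Q': "\<And>i. open (Q' i)" "\<And>i. Q i = K \<inter> Q' i"
    unfolding openin_open by metis
  define \<W> where "\<W> = P' ` {..<n} \<union> Q' ` {..<n}"
  have W1: "\<forall>W\<in>\<W>. open W" using P' Q' by (auto simp: \<W>_def)
  have W2: "K \<subseteq> \<Union>\<W>"
  proof
    fix x assume "x \<in> K"
    then obtain i where "i < n" "x \<in> P i \<union> Q i" using KPQ by blast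
    then show "x \<in> \<Union>\<W>" using P'(2)[of i] Q'(2)[of i] by (auto simp: \<W>_def)
  qed
  obtain N \<phi> where N: "0 < N" and \<phi>K: "\<forall>x. \<phi> x \<in> K"
    and faces: "\<forall>x. \<forall>i<n. (x i = 0 \<longrightarrow> \<phi> x \<in> A i) \<and> (N \<le> x i \<longrightarrow> \<phi> x \<in> B i)"
    and cell: "\<forall>q. \<exists>U\<in>\<W>. \<forall>x. (\<forall>i<n. q i \<le> x i \<and> x i \<le> q i + 1) \<longrightarrow> \<phi> (x :: nat \<Rightarrow> nat) \<in> U"
    using grid_essentialD[OF ess W1 W2] by (elim exE conjE) (rule that)
  \<comment> \<open>Label \<open>i\<close> is 1 on \<open>P i\<close> and 0 on \<open>Q i\<close>.
    Since \<open>A i\<close> misses \<open>B i\<close> and \<open>P i\<close>, the faces receive the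
    boundary values that Kuhn's lemma asks for.\<close>
  define label :: "(nat \<Rightarrow> nat) \<Rightarrow> nat \<Rightarrow> nat" where
    "label x i = (if \<phi> x \<in> B i \<union> P i then 1 else 0)" for x i
  have l0: "label x i = 0" if "i < n" "x i = 0" for x i
  proof -
    have "\<phi> x \<in> A i" using faces that by blast
    then show ?thesis using AB(3)[OF that(1)] PA[of i] by (auto simp: label_def)
  qed
  have l1: "label x i = 1" if "i < n" "x i = N" for x i
    using faces that by (simp add: label_def)
  have kuhn: "\<forall>x. (\<forall>i<n. x i \<le> N) \<longrightarrow> (\<forall>i<n. label x i = 0 \<or> label x i = 1)"
    "\<forall>x. (\<forall>i<n. x i \<le> N) \<longrightarrow> (\<forall>i<n. x i = 0 \<longrightarrow> label x i = 0)"
    "\<forall>x. (\<forall>i<n. x i \<le> N) \<longrightarrow> (\<forall>i<n. x i = N \<longrightarrow> label x i = 1)"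
    using l0 l1 by (auto simp: label_def)
  obtain q where "\<forall>i<n. q i < N" and q: "\<forall>i<n. \<exists>r s.
      (\<forall>j<n. q j \<le> r j \<and> r j \<le> q j + 1) \<and> (\<forall>j<n. q j \<le> s j \<and> s j \<le> q j + 1) \<and>
      label r i \<noteq> label s i"
    by (rule kuhn_lemma[OF N kuhn])
  \<comment> \<open>The cell found is mapped into a single \<open>P' i\<close> or
    \<open>Q' i\<close>, where label \<open>i\<close> cannot change.\<close>
  obtain W where W: "W \<in> \<W>" "\<forall>x. (\<forall>i<n. q i \<le> x i \<and> x i \<le> q i + 1) \<longrightarrow> \<phi> x \<in> W"
    using cell[rule_format, of q] by (elim bexE)
  then obtain i where i: "i < n" "W = P' i \<or> W = Q' i" by (auto simp: \<W>_def)
  obtain r s where "\<forall>j<n. q j \<le> r j \<and> r j \<le> q j + 1"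
      "\<forall>j<n. q j \<le> s j \<and> s j \<le> q j + 1" and rs: "label r i \<noteq> label s i"
    using q[rule_format, OF i(1)] by (elim exE conjE) (rule that)
  then have rsW: "\<phi> r \<in> W" "\<phi> s \<in> W" using W(2)[rule_format] by simp_all
  from i(2) show False
  proof
    assume "W = P' i"
    then have "\<phi> r \<in> P i" "\<phi> s \<in> P i" using rsW P'(2)[of i] \<phi>K by auto
    then show False using rs by (simp add: label_def)
  next
    assume "W = Q' i"
    then have "\<phi> r \<in> Q i" "\<phi> s \<in> Q i" using rsW Q'(2)[of i] \<phi>K by auto
    then have "\<phi> r \<notin> B i \<union> P i" "\<phi> s \<notin> B i \<union> P i" using QB[OF i(1)] PQ[of i] by auto
    then show False using rs by (simp add: label_def)
  qed
qed

text \<open>Turns the extended real supremum into one natural number for all compact sets, with a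
  strict bound as in the hypothesis on \<open>d\<close> in the preceding lemma.\<close>

lemma compactly_finite_dimensional_bound:
  assumes "compactly_finite_dimensional X"
  shows "\<exists>n :: nat. \<forall>K. compactin X K \<longrightarrow>
    (\<exists>d. d < int n \<and> covering_dim_le (subtopology X K) d)"
proof -
  obtain r :: real where r: "(SUP K\<in>{K. compactin X K}. covering_dim (subtopology X K)) < ereal r"
    using assms ereal_dense2 unfolding compactly_finite_dimensional_def by blast
  have "\<exists>d. d < int (nat \<lceil>r\<rceil>) \<and> covering_dim_le (subtopology X K) d" if K: "compactin X K" for K
  proof -
    have "covering_dim (subtopology X K) < ereal r"
      using K r by (intro le_less_trans[OF SUP_upper r]) simp
    then obtain d where d: "covering_dim_le (subtopology X K) d" "ereal (real_of_int d) < ereal r"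
      unfolding covering_dim_def Inf_less_iff by auto
    then have "d < \<lceil>r\<rceil>" by (simp add: less_ceiling_iff)
    then have "d < int (nat \<lceil>r\<rceil>)" by linarith
    then show ?thesis using d by blast
  qed
  then show ?thesis by blast
qed

section \<open>Sums of continua in a topological group\<close>

text \<open>This is \<open>tube_refinement\<close> for the preimage of \<open>U\<close> under
  addition, a one-member cover of the product of \<open>A\<close> and \<open>{0}\<close>.\<close>

lemma compact_translates_subset:
  fixes A :: "'a::topological_group_add set"
  assumes "compact A" "open U" "A \<subseteq> U"
  shows "\<exists>W. open W \<and> 0 \<in> W \<and> (\<forall>a\<in>A. \<forall>w\<in>W. a + w \<in> U)"
proof -
  let ?f = "\<lambda>z :: 'a \<times> 'a. fst z + snd z"
  have "continuous_on UNIV ?f" by (intro continuous_intros)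
  then have "open (?f -` U)" using assms(2) by (rule open_vimage[rotated])
  moreover have "A \<times> {0} \<subseteq> ?f -` U" using assms(3) by auto
  ultimately obtain \<O> \<Q> where "A \<subseteq> \<Union>\<O>" and \<Q>: "\<forall>Q\<in>\<Q>. open Q" "{0} \<subseteq> \<Union>\<Q>"
    and sub: "\<forall>P\<in>\<O>. \<forall>Q\<in>\<Q>. \<exists>U'\<in>{?f -` U}. P \<times> Q \<subseteq> U'"
    using tube_refinement[OF assms(1), of "{0}" "{?f -` U}"] by auto
  from \<Q>(2) obtain Q where Q: "Q \<in> \<Q>" "0 \<in> Q" by blast
  have "a + w \<in> U" if aw: "a \<in> A" "w \<in> Q" for a w
  proof -
    obtain P where "P \<in> \<O>" "a \<in> P" using \<open>A \<subseteq> \<Union>\<O>\<close> aw by blast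
    then have "(a, w) \<in> ?f -` U" using sub Q aw by blast
    then show ?thesis by simp
  qed
  then show ?thesis using Q \<Q>(1) by blast
qed

text \<open>Tells how small a further continuum must be for two opposite faces to stay disjoint when
  it is added to both.\<close>

lemma compact_disjoint_translates:
  fixes A B :: "'a::{topological_group_add, t2_space} set"
  assumes "compact A" "compact B" "A \<inter> B = {}"
  shows "\<exists>W. open W \<and> 0 \<in> W \<and> (\<forall>a\<in>A. \<forall>b\<in>B. \<forall>v\<in>W. \<forall>w\<in>W. a + v \<noteq> b + w)"
proof -
  obtain U V where UV: "openin euclidean U" "openin euclidean V" "A \<subseteq> U" "B \<subseteq> V" "disjnt U V"
    by (rule Hausdorff_space_compact_separation[OF Hausdorff_space_euclidean_t2, of A B])
      (use assms in \<open>simp_all add: disjnt_def\<close>)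
  then have op: "open U" "open V" by simp_all
  obtain W1 where W1: "open W1" "0 \<in> W1" "\<forall>a\<in>A. \<forall>w\<in>W1. a + w \<in> U"
    using compact_translates_subset[OF assms(1) op(1) UV(3)] by (elim exE conjE) (rule that)
  obtain W2 where W2: "open W2" "0 \<in> W2" "\<forall>b\<in>B. \<forall>w\<in>W2. b + w \<in> V"
    using compact_translates_subset[OF assms(2) op(2) UV(4)] by (elim exE conjE) (rule that)
  have "a + v \<noteq> b + w" if "a \<in> A" "b \<in> B" "v \<in> W1" "w \<in> W2" for a b v w
  proof -
    have "a + v \<in> U" "b + w \<in> V" using W1(3) W2(3) that by blast+
    then show ?thesis using UV(5) by (auto simp: disjnt_iff)
  qed
  then show ?thesis
    using W1 W2 by (intro exI[of _ "W1 \<inter> W2"]) auto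
qed

text \<open>The invariant of the inductive construction. The summands are not recorded: the next
  step uses only the set, its faces and its grid maps.\<close>

definition essential_sum :: "nat \<Rightarrow> 'a::topological_group_add set \<Rightarrow> (nat \<Rightarrow> 'a set) \<Rightarrow> (nat \<Rightarrow> 'a set) \<Rightarrow> bool" where
  "essential_sum m K A B \<longleftrightarrow> compact K \<and> countable_network K \<and>
     (\<forall>i<m. compact (A i) \<and> compact (B i) \<and> A i \<inter> B i = {}) \<and> grid_essential m K A B"

lemma continuous_on_fst_plus_snd:
  fixes S :: "('a::topological_monoid_add \<times> 'a) set"
  shows "continuous_on S (\<lambda>z. fst z + snd z)"
  by (intro continuous_intros)

lemma essential_sum_0: "essential_sum 0 {0} A B"
  by (simp add: essential_sum_def countable_network_singleton grid_essential_0)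

text \<open>Addition maps the product of \<open>K\<close> and \<open>C\<close> onto the new sum. Old
  pairs of faces stay disjoint because \<open>C\<close> is small (\<open>sep\<close>); the new pair
  is \<open>K\<close> and its translate by \<open>c\<close>, disjoint because \<open>c\<close>
  avoids all differences \<open>- k + l\<close>.\<close>

lemma essential_sum_Suc:
  fixes K :: "'a::topological_group_add set"
  assumes ess: "essential_sum m K A B"
    and C: "compact C" "connected C" "countable_network C" "0 \<in> C" "c \<in> C"
    and c: "\<forall>k\<in>K. \<forall>l\<in>K. c \<noteq> - k + l"
    and sep: "\<forall>i<m. \<forall>a\<in>A i. \<forall>b\<in>B i. \<forall>v\<in>C. \<forall>w\<in>C. a + v \<noteq> b + w"
  shows "\<exists>K' A' B'. essential_sum (Suc m) K' A' (B' :: nat \<Rightarrow> 'a set)"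
proof -
  define A' where "A' i = (if i < m then A i \<times> C else K \<times> {0})" for i
  define B' where "B' i = (if i < m then B i \<times> C else K \<times> {c})" for i
  let ?f = "\<lambda>z :: 'a \<times> 'a. fst z + snd z"
  have K: "compact K" "countable_network K" "grid_essential m K A B"
    and AB: "\<forall>i<m. compact (A i) \<and> compact (B i)"
    using ess by (auto simp: essential_sum_def)
  have "essential_sum (Suc m) (?f ` (K \<times> C)) (\<lambda>i. ?f ` A' i) (\<lambda>i. ?f ` B' i)"
    unfolding essential_sum_def
  proof (intro conjI allI impI)
    show "compact (?f ` (K \<times> C))"
      by (intro compact_continuous_image continuous_on_fst_plus_snd compact_Times K C)
    show "countable_network (?f ` (K \<times> C))"
      by (intro countable_network_image countable_network_Times continuous_on_fst_plus_snd K C)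
    show "grid_essential (Suc m) (?f ` (K \<times> C)) (\<lambda>i. ?f ` A' i) (\<lambda>i. ?f ` B' i)"
      unfolding A'_def B'_def
      by (intro grid_essential_image grid_essential_Times continuous_on_fst_plus_snd K C)
    fix i assume "i < Suc m"
    show "compact (?f ` A' i)" "compact (?f ` B' i)"
      using K AB C unfolding A'_def B'_def
      by (auto intro!: compact_continuous_image continuous_on_fst_plus_snd compact_Times)
    show "?f ` A' i \<inter> ?f ` B' i = {}"
    proof (cases "i < m")
      case True
      then show ?thesis using sep by (auto simp: A'_def B'_def)
    next
      case False
      \<comment> \<open>The order of the summands matters, since the group need not be
        commutative.\<close>
      have "k \<noteq> l + c" if "k \<in> K" "l \<in> K" for k l
      proof
        assume "k = l + c"
        then have "c = - l + k" by (simp add: minus_add_cancel)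
        then show False using c that by blast
      qed
      then show ?thesis using False by (auto simp: A'_def B'_def)
    qed
  qed
  then show ?thesis by blast
qed

lemma continuum_subtopologyD:
  assumes "continuum (subtopology (top_of_set X) L)" "L \<subseteq> X"
  shows "compact L" "connected L"
proof -
  have "subtopology (top_of_set X) L = top_of_set L"
    using assms(2) by (simp add: subtopology_subtopology Int_absorb1)
  then have "compactin euclidean L" "connectedin euclidean L"
    using assms(1) by (auto simp: continuum_def compactin_subspace connectedin_def)
  then show "compact L" "connected L" by simp_all
qed

text \<open>Without a compact hull near \<open>x\<close>, arbitrarily small neighbourhoods of
  \<open>x\<close> in \<open>X\<close> leave the compact set \<open>x - K + K\<close>. A small
  continuum from \<open>x\<close> to a point outside it, translated to 0, is the next
  summand.\<close>

lemma essential_sum_extend: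
  fixes X :: "'g::{topological_group_add, t2_space} set"
  assumes lcc: "locally_continuum_connected_at (top_of_set X) x" and x: "x \<in> X"
    and net: "countable_network X" and ess: "essential_sum m K A (B :: nat \<Rightarrow> 'g set)"
    and no: "\<not> (\<exists>V M. openin (top_of_set X) V \<and> x \<in> V \<and> V \<subseteq> M \<and> compact M \<and> countable_network M)"
  shows "\<exists>K' A' B'. essential_sum (Suc m) K' A' (B' :: nat \<Rightarrow> 'g set)"
proof -
  have K: "compact K" "countable_network K"
    and AB: "\<forall>i<m. compact (A i) \<and> compact (B i) \<and> A i \<inter> B i = {}"
    using ess by (auto simp: essential_sum_def)
  have "\<forall>i\<in>{..<m}. \<exists>W. open W \<and> 0 \<in> W \<and> (\<forall>a\<in>A i. \<forall>b\<in>B i. \<forall>v\<in>W. \<forall>w\<in>W. a + v \<noteq> b + w)"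
  proof
    fix i assume "i \<in> {..<m}"
    then have "compact (A i)" "compact (B i)" "A i \<inter> B i = {}" using AB by auto
    then show "\<exists>W. open W \<and> 0 \<in> W \<and> (\<forall>a\<in>A i. \<forall>b\<in>B i. \<forall>v\<in>W. \<forall>w\<in>W. a + v \<noteq> b + w)"
      by (rule compact_disjoint_translates)
  qed
  then obtain W where W: "\<forall>i\<in>{..<m}. open (W i) \<and> 0 \<in> W i \<and>
      (\<forall>a\<in>A i. \<forall>b\<in>B i. \<forall>v\<in>W i. \<forall>w\<in>W i. a + v \<noteq> b + w)"
    by (rule bchoice[THEN exE])
  \<comment> \<open>A continuum inside \<open>W0\<close> keeps all old faces apart; for
    \<open>m = 0\<close> this is the whole group.\<close>
  define W0 where "W0 = (\<Inter>i<m. W i)"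
  have W0: "open W0" "0 \<in> W0" using W by (auto simp: W0_def intro!: open_INT)
  define t where "t = (\<lambda>y. - x + y)"
  have t: "continuous_on S t" for S unfolding t_def by (intro continuous_intros)
  have "open (t -` W0)" using W0(1) t by (rule open_vimage)
  then have "openin (top_of_set X) (X \<inter> t -` W0) \<and> x \<in> X \<inter> t -` W0"
    using x W0 by (simp add: openin_open_Int t_def)
  from mp[OF spec[OF lcc[unfolded locally_continuum_connected_at_def]] this]
  obtain V where V: "openin (top_of_set X) V" "x \<in> V"
    and cont: "\<forall>y\<in>V. \<exists>L. L \<subseteq> X \<inter> t -` W0 \<and> continuum (subtopology (top_of_set X) L) \<and> x \<in> L \<and> y \<in> L"
    by (elim exE conjE) (rule that)
  \<comment> \<open>A point \<open>y\<close> lies outside \<open>M\<close> exactly when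
    \<open>t y\<close> has no form \<open>- k + l\<close> with \<open>k\<close> and \<open>l\<close>
    in \<open>K\<close>, as the new faces require.\<close>
  define M where "M = (\<lambda>z. x + (- fst z + snd z)) ` (K \<times> K)"
  have f: "continuous_on (K \<times> K) (\<lambda>z. x + (- fst z + snd z))"
    by (intro continuous_intros)
  have "compact M" unfolding M_def by (intro compact_continuous_image f compact_Times K)
  moreover have "countable_network M"
    unfolding M_def by (intro countable_network_image f countable_network_Times K)
  ultimately have "\<not> V \<subseteq> M" using V no by blast
  then obtain y where y: "y \<in> V" "y \<notin> M" by blast
  obtain L where LW: "L \<subseteq> X \<inter> t -` W0"
    and L': "continuum (subtopology (top_of_set X) L)" "x \<in> L" "y \<in> L"
    using bspec[OF cont y(1)] by (elim exE conjE) (rule that)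
  then have L: "L \<subseteq> X" "L \<subseteq> t -` W0" "continuum (subtopology (top_of_set X) L)" "x \<in> L" "y \<in> L"
    by simp_all
  show ?thesis
  proof (rule essential_sum_Suc[OF ess, of "t ` L" "t y"])
    show "compact (t ` L)" "connected (t ` L)"
      using continuum_subtopologyD[OF L(3,1)] t
      by (auto intro: compact_continuous_image connected_continuous_image)
    show "countable_network (t ` L)"
      by (intro countable_network_image countable_network_subset[OF net] L t)
    show "0 \<in> t ` L" using L(4) by (force simp: t_def)
    show "t y \<in> t ` L" using L(5) by blast
    show "\<forall>k\<in>K. \<forall>l\<in>K. t y \<noteq> - k + l"
    proof (intro ballI notI)
      fix k l assume kl: "k \<in> K" "l \<in> K" "t y = - k + l"
      then have "y = x + (- k + l)" unfolding t_def by (metis add.assoc add_0 add.right_inverse)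
      then show False using y kl by (force simp: M_def)
    qed
    show "\<forall>i<m. \<forall>a\<in>A i. \<forall>b\<in>B i. \<forall>v\<in>t ` L. \<forall>w\<in>t ` L. a + v \<noteq> b + w"
    proof (intro allI impI ballI)
      fix i a b v w assume i: "i < m" "a \<in> A i" "b \<in> B i" "v \<in> t ` L" "w \<in> t ` L"
      have "t ` L \<subseteq> W i" using L(2) i(1) by (auto simp: W0_def)
      then have "v \<in> W i" "w \<in> W i" using i(4,5) by blast+
      then show "a + v \<noteq> b + w" using bspec[OF W, of i] i(1-3) by simp
    qed
  qed
qed

section \<open>Compact hulls and metrizability of \<open>X\<close>\<close>

text \<open>If there were no such hull at \<open>x\<close>, the extension step could be repeated at
  \<open>x\<close> for ever. After \<open>n\<close> steps the sum would be too large for the uniform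
  dimension bound.\<close>

lemma locally_small_in_compact:
  fixes X :: "'g::{topological_group_add, t2_space} set"
  assumes cfd: "compactly_finite_dimensional (euclidean :: 'g topology)"
    and lcc: "locally_continuum_connected_at (top_of_set X) x" and x: "x \<in> X"
    and net: "countable_network X"
  shows "\<exists>V M. openin (top_of_set X) V \<and> x \<in> V \<and> V \<subseteq> M \<and> compact M \<and> countable_network M"
proof (rule ccontr)
  assume no: "\<not> ?thesis"
  have ess: "\<exists>K A B. essential_sum m K A (B :: nat \<Rightarrow> 'g set)" for m
  proof (induction m)
    case 0
    show ?case using essential_sum_0 by blast
  next
    case (Suc m)
    then show ?case using essential_sum_extend[OF lcc x net _ no] by blast
  qed
  obtain n :: nat where n: "\<forall>K. compactin (euclidean :: 'g topology) K \<longrightarrow>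
      (\<exists>d. d < int n \<and> covering_dim_le (top_of_set K) d)"
    using compactly_finite_dimensional_bound[OF cfd] by blast
  obtain K A B where KAB: "essential_sum n K A (B :: nat \<Rightarrow> 'g set)" using ess by blast
  then obtain d where d: "d < int n" "covering_dim_le (top_of_set K) d"
    using n by (auto simp: essential_sum_def)
  moreover have "\<not> covering_dim_le (top_of_set K) d"
    using KAB d(1) compact_imp_closed unfolding essential_sum_def
    by (intro grid_essential_imp_not_covering_dim_le[of K n A B]) auto
  ultimately show False by blast
qed

text \<open>Countably many of the given neighbourhoods cover \<open>X\<close>, selected through the members of a
  network that are contained in one of them.\<close>

lemma second_countable_of_local_compact_hulls:
  fixes X :: "'a::t2_space set"
  assumes net: "countable_network X"
    and loc: "\<And>x. x \<in> X \<Longrightarrow>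
      \<exists>V M. openin (top_of_set X) V \<and> x \<in> V \<and> V \<subseteq> M \<and> compact M \<and> countable_network M"
  shows "second_countable (top_of_set X)"
proof -
  obtain \<N> where \<N>: "countable \<N>"
      "\<forall>U x. open U \<longrightarrow> x \<in> X \<inter> U \<longrightarrow> (\<exists>N\<in>\<N>. x \<in> N \<and> N \<subseteq> U)"
    using net unfolding countable_network_def by blast
  \<comment> \<open>The traces of \<open>\<B>\<close> form a countable base of
    \<open>X \<inter> O'\<close>. A hull \<open>M\<close> provides one, because a base of
    \<open>M\<close> restricts to the part of \<open>X\<close> inside it.\<close>
  define good where "good O' \<B> \<longleftrightarrow> open O' \<and> countable \<B> \<and> (\<forall>B\<in>\<B>. open B) \<and>
      (\<forall>U x. open U \<longrightarrow> x \<in> X \<inter> O' \<inter> U \<longrightarrow> (\<exists>B\<in>\<B>. x \<in> B \<and> B \<inter> X \<inter> O' \<subseteq> U))"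
    for O' :: "'a set" and \<B>
  have good: "\<exists>O' \<B>. x \<in> O' \<and> good O' \<B>" if x: "x \<in> X" for x
  proof -
    obtain V M where V: "openin (top_of_set X) V" "x \<in> V" "V \<subseteq> M" "compact M" "countable_network M"
      using loc[OF x] by blast
    obtain \<B> where \<B>: "countable \<B>" "\<forall>B\<in>\<B>. open B"
      "\<forall>U x. open U \<longrightarrow> x \<in> M \<inter> U \<longrightarrow> (\<exists>B\<in>\<B>. x \<in> B \<and> B \<inter> M \<subseteq> U)"
      using compact_countable_network_base[OF V(4,5)] by (elim exE conjE) (rule that)
    obtain O' where O': "open O'" "V = X \<inter> O'" using V(1) unfolding openin_open by blast
    have "\<exists>B\<in>\<B>. z \<in> B \<and> B \<inter> X \<inter> O' \<subseteq> U" if z: "open U" "z \<in> X \<inter> O' \<inter> U" for U z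
    proof -
      have "z \<in> M \<inter> U" using z O' V by blast
      then obtain B where "B \<in> \<B>" "z \<in> B" "B \<inter> M \<subseteq> U" using \<B>(3) z(1) by blast
      then show ?thesis using O' V(3) by blast
    qed
    then have "good O' \<B>" using \<B> O' by (simp add: good_def)
    moreover have "x \<in> O'" using V O' by blast
    ultimately show ?thesis by blast
  qed
  \<comment> \<open>Choosing one good open set per network member, rather than per point, keeps the
    choices countable.\<close>
  define J where "J = {N \<in> \<N>. \<exists>p. N \<subseteq> fst p \<and> good (fst p) (snd p)}"
  have "\<forall>N\<in>J. \<exists>p. N \<subseteq> fst p \<and> good (fst p) (snd p)" by (simp add: J_def)
  then obtain p where p: "\<forall>N\<in>J. N \<subseteq> fst (p N) \<and> good (fst (p N)) (snd (p N))"
    by (rule bchoice[THEN exE])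
  define \<C> where "\<C> = (\<Union>N\<in>J. (\<lambda>B. X \<inter> (fst (p N) \<inter> B)) ` snd (p N))"
  have "countable J" using \<N>(1) by (simp add: J_def)
  then have "countable \<C>"
    unfolding \<C>_def using p by (auto simp: good_def)
  moreover have "\<forall>V\<in>\<C>. openin (top_of_set X) V"
    unfolding \<C>_def using p by (auto simp: good_def intro!: openin_open_Int open_Int)
  moreover have "\<exists>V\<in>\<C>. x \<in> V \<and> V \<subseteq> U" if U: "openin (top_of_set X) U" "x \<in> U" for U x
  proof -
    obtain U' where U': "open U'" "U = X \<inter> U'" using U(1) unfolding openin_open by blast
    then have x: "x \<in> X" using U by blast
    obtain O' \<B> where O': "x \<in> O'" "good O' \<B>" using good[OF x] by blast
    have "open O'" using O'(2) by (simp add: good_def)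
    then obtain N where N: "N \<in> \<N>" "x \<in> N" "N \<subseteq> O'" using \<N>(2) x O'(1) by blast
    then have NJ: "N \<in> J" using O' by (auto simp: J_def)
    then have pN: "x \<in> fst (p N)" "good (fst (p N)) (snd (p N))" using p N by blast+
    have "x \<in> X \<inter> fst (p N) \<inter> U'" using x pN U U' by blast
    then obtain B where "B \<in> snd (p N)" "x \<in> B" "B \<inter> X \<inter> fst (p N) \<subseteq> U'"
      using pN(2) U'(1) unfolding good_def by blast
    then show ?thesis
      using NJ x pN U' unfolding \<C>_def by (intro bexI[of _ "X \<inter> (fst (p N) \<inter> B)"]) auto
  qed
  ultimately show ?thesis unfolding second_countable_def by blast
qed

theorem theorem1p2:
  fixes X :: "'g::{topological_group_add, t2_space} set"
  assumes "compactly_finite_dimensional (euclidean :: 'g topology)"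
    and "locally_continuum_connected (top_of_set X)"
    and "cosmic_space (top_of_set X)"
  shows "metrizable_space (top_of_set X) \<and>
         (closed X \<longrightarrow> metrizable_space (top_of_set X) \<and> locally_compact_space (top_of_set X))"
proof -
  have net: "countable_network X" using assms(3) by (rule cosmic_space_imp_countable_network)
  have loc: "\<exists>V M. openin (top_of_set X) V \<and> x \<in> V \<and> V \<subseteq> M \<and> compact M \<and> countable_network M"
    if x: "x \<in> X" for x
    using assms(2) x by (intro locally_small_in_compact[OF assms(1) _ x net])
      (simp add: locally_continuum_connected_def)
  \<comment> \<open>Regularity and the Hausdorff property come from cosmicity, second countability
    from the compact hulls.\<close>
  have metr: "metrizable_space (top_of_set X)"
    using assms(3) second_countable_of_local_compact_hulls[OF net loc]
    by (intro regular_second_countable_imp_metrizable_space) (auto simp: cosmic_space_def)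
  have "locally_compact_space (top_of_set X)" if "closed X"
    unfolding locally_compact_space_def
  proof
    fix x assume "x \<in> topspace (top_of_set X)"
    then have "x \<in> X" by simp
    then obtain V M where V: "openin (top_of_set X) V" "x \<in> V" "V \<subseteq> M" "compact M"
      using loc by blast
    \<comment> \<open>The hull \<open>M\<close> may stick out of \<open>X\<close>; closedness makes
      its trace on \<open>X\<close> compact.\<close>
    have "compactin (top_of_set X) (X \<inter> M)"
      using \<open>closed X\<close> V(4) by (simp add: compactin_subtopology closed_Int_compact)
    moreover have "V \<subseteq> X \<inter> M" using openin_subset[OF V(1)] V(3) by auto
    ultimately show "\<exists>U K. openin (top_of_set X) U \<and> compactin (top_of_set X) K \<and> x \<in> U \<and> U \<subseteq> K"
      using V by blast
  qed
  with metr show ?thesis by blast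
qed

end
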